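(* Let $q$ be a positive integer and let $m$ be a $q$-uniformly rational flow measure on a tree $T$ with root at infinity. Then $(T,m)$ is a flow quotient of the homogeneous tree $\mathbb{T}_q$ equipped with the canonical flow $m_{\mathbb{T}_q}$. More precisely, for any given $\overline{w_0}\in\mathbb{T}_q$ and $w_0\in T$, there is a flow submersion $\pi:(\mathbb{T}_q,m_{\mathbb{T}_q})\to(T,m)$ such that $\pi(\overline{w_0})=w_0$.
   Context: A tree $T$ is an infinite connected graph without cycles, locally finite, identified with its set of vertices. A tree with root at infinity is such a tree with a fixed boundary point (end) $\omega_*\in\partial T$. For $x\in T$, the predecessor $\mathfrak{p}(x)$ is the neighbour of $x$ lying on the semi-infinite geodesic from $x$ to $\omega_*$; the remaining neighbours form the set $\mathfrak{s}(x)$ of successors. A level function $\ell:T\to\mathbb{Z}$ with $\ell(\mathfrak{p}(x))=\ell(x)+1$ is fixed. A flow measure on $T$ is a function $m:T\to(0,\infty)$ with $m(x)=\sum_{y\in\mathfrak{s}(x)}m(y)$ for all $x$, identified with the measure of density $m$ with respect to counting measure; $(T,m)$ is then a flow tree. $m$ is $q$-uniformly rational if $q\,m(x)/m(\mathfrak{p}(x))$ is a positive integer for every $x\in T$. $\mathbb{T}_q$ is the homogeneous tree with root at infinity in which every vertex has exactly $q$ successors, and $m_{\mathbb{T}_q}(x)=q^{\ell(x)}$. A map $\pi:T_1\to T_2$ between trees with root at infinity is a submersion if $\pi(\mathfrak{p}(x))=\mathfrak{p}(\pi(x))$ and $\pi(\mathfrak{s}(x))=\mathfrak{s}(\pi(x))$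 for all $x\in T_1$. For flow trees $(T_1,m_1),(T_2,m_2)$, a submersion $\pi:T_1\to T_2$ is a flow submersion if $$\frac{m_2(\pi(x))}{m_2(\mathfrak{p}(\pi(x)))}=\frac{m_1(\pi^{-1}\{\pi(x)\}\cap\mathfrak{s}(\mathfrak{p}(x)))}{m_1(\mathfrak{p}(x))}\qquad\forall x\in T_1;$$ in this case $(T_2,m_2)$ is called a flow quotient of $(T_1,m_1)$. *)

theory Defs
  imports Complex_Main "Graph_Theory.Graph_Theory"
begin

text \<open>
  Undirected simple graphs are symmetric loop-free digraphs (\<open>pair_bidirected_digraph\<close>). In a
  symmetric digraph \<open>x, y, x\<close> counts as a \<open>cycle\<close> of length 2, so acyclicity of the underlying
  undirected graph only excludes cycles of length at least 3 (and \<open>forest\<close>, \<open>tree\<close> from the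
  library are not applicable).
\<close>

definition inf_tree :: "'a pair_pre_digraph \<Rightarrow> bool" where
  "inf_tree G \<longleftrightarrow>
     pair_bidirected_digraph G \<and>
     connected (with_proj G) \<and>
     \<not> (\<exists>p. pre_digraph.cycle (with_proj G) p \<and> length p \<ge> 3) \<and>
     infinite (pverts G) \<and>
     (\<forall>x\<in>pverts G. finite {y. (x, y) \<in> parcs G})"

definition gdist :: "'a pair_pre_digraph \<Rightarrow> 'a \<Rightarrow> 'a \<Rightarrow> nat" where
  "gdist G x y = (LEAST n. \<exists>p. pre_digraph.awalk (with_proj G) x p y \<and> length p = n)"

definition geodesic_rays :: "'a pair_pre_digraph \<Rightarrow> (nat \<Rightarrow> 'a) set" where
  "geodesic_rays G =
     {f. range f \<subseteq> pverts G \<and> (\<forall>i j. i \<le> j \<longrightarrow> gdist G (f i) (f j) = j - i)}"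

text \<open>
  A boundary point (end) of a tree is a class of geodesic rays, two rays being equivalent if they
  eventually coincide up to a shift of the parameter.
\<close>

definition cofinal_rel :: "'a pair_pre_digraph \<Rightarrow> ((nat \<Rightarrow> 'a) \<times> (nat \<Rightarrow> 'a)) set" where
  "cofinal_rel G =
     {(f, g). f \<in> geodesic_rays G \<and> g \<in> geodesic_rays G \<and> (\<exists>i j. \<forall>n. f (i + n) = g (j + n))}"

definition tree_boundary :: "'a pair_pre_digraph \<Rightarrow> (nat \<Rightarrow> 'a) set set" where
  "tree_boundary G = geodesic_rays G // cofinal_rel G"

record 'a end_tree =
  skeleton :: "'a pair_pre_digraph"
  root_end :: "(nat \<Rightarrow> 'a) set"
  level :: "'a \<Rightarrow> int"

abbreviation vertices :: "'a end_tree \<Rightarrow> 'a set" where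
  "vertices T \<equiv> pverts (skeleton T)"

definition neighbours :: "'a end_tree \<Rightarrow> 'a \<Rightarrow> 'a set" where
  "neighbours T x = {y. (x, y) \<in> parcs (skeleton T)}"

definition predecessor :: "'a end_tree \<Rightarrow> 'a \<Rightarrow> 'a" where
  "predecessor T x = (THE y. y \<in> neighbours T x \<and> (\<exists>f\<in>root_end T. f 0 = x \<and> y \<in> range f))"

definition successors :: "'a end_tree \<Rightarrow> 'a \<Rightarrow> 'a set" where
  "successors T x = neighbours T x - {predecessor T x}"

definition tree_root_at_infinity :: "'a end_tree \<Rightarrow> bool" where
  "tree_root_at_infinity T \<longleftrightarrow>
     inf_tree (skeleton T) \<and>
     root_end T \<in> tree_boundary (skeleton T) \<and>
     (\<forall>x\<in>vertices T. level T (predecessor T x) = level T x + 1)"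

definition flow_measure :: "'a end_tree \<Rightarrow> ('a \<Rightarrow> real) \<Rightarrow> bool" where
  "flow_measure T m \<longleftrightarrow>
     (\<forall>x\<in>vertices T. m x > 0 \<and> m x = (\<Sum>y\<in>successors T x. m y))"

definition flow_tree :: "'a end_tree \<Rightarrow> ('a \<Rightarrow> real) \<Rightarrow> bool" where
  "flow_tree T m \<longleftrightarrow> tree_root_at_infinity T \<and> flow_measure T m"

definition uniformly_rational :: "nat \<Rightarrow> 'a end_tree \<Rightarrow> ('a \<Rightarrow> real) \<Rightarrow> bool" where
  "uniformly_rational q T m \<longleftrightarrow>
     (\<forall>x\<in>vertices T. \<exists>k::nat. k > 0 \<and> real q * m x / m (predecessor T x) = real k)"

text \<open>
  The homogeneous tree with root at infinity is unique up to isomorphism; this predicate describes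
  all its realisations, with any level function.
\<close>

definition homogeneous_tree :: "nat \<Rightarrow> 'a end_tree \<Rightarrow> bool" where
  "homogeneous_tree q T \<longleftrightarrow>
     tree_root_at_infinity T \<and>
     (\<forall>x\<in>vertices T. finite (successors T x) \<and> card (successors T x) = q)"

definition canonical_flow :: "nat \<Rightarrow> 'a end_tree \<Rightarrow> 'a \<Rightarrow> real" where
  "canonical_flow q T x = real q powi level T x"

definition submersion :: "'a end_tree \<Rightarrow> 'b end_tree \<Rightarrow> ('a \<Rightarrow> 'b) \<Rightarrow> bool" where
  "submersion T1 T2 \<pi> \<longleftrightarrow>
     \<pi> ` vertices T1 \<subseteq> vertices T2 \<and>
     (\<forall>x\<in>vertices T1. \<pi> (predecessor T1 x) = predecessor T2 (\<pi> x) \<and>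
        \<pi> ` successors T1 x = successors T2 (\<pi> x))"

text \<open>The measure of a finite set of vertices is the sum of the density over it.\<close>

definition flow_submersion ::
  "'a end_tree \<Rightarrow> ('a \<Rightarrow> real) \<Rightarrow> 'b end_tree \<Rightarrow> ('b \<Rightarrow> real) \<Rightarrow> ('a \<Rightarrow> 'b) \<Rightarrow> bool" where
  "flow_submersion T1 m1 T2 m2 \<pi> \<longleftrightarrow>
     flow_tree T1 m1 \<and> flow_tree T2 m2 \<and> submersion T1 T2 \<pi> \<and>
     (\<forall>x\<in>vertices T1.
        m2 (\<pi> x) / m2 (predecessor T2 (\<pi> x)) =
        sum m1 ({y \<in> vertices T1. \<pi> y = \<pi> x} \<inter> successors T1 (predecessor T1 x))
          / m1 (predecessor T1 x))"

definition flow_quotient ::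
  "'b end_tree \<Rightarrow> ('b \<Rightarrow> real) \<Rightarrow> 'a end_tree \<Rightarrow> ('a \<Rightarrow> real) \<Rightarrow> bool" where
  "flow_quotient T2 m2 T1 m1 \<longleftrightarrow> (\<exists>\<pi>. flow_submersion T1 m1 T2 m2 \<pi>)"

end

theory Submission
  imports Defs
begin

text \<open>
  Put \<open>k(u) = q m(u) / m(p(u))\<close>. The flow condition says that the positive integers \<open>k(u)\<close>,
  \<open>u \<in> s(v)\<close>, sum up to \<open>q\<close>, so the \<open>q\<close> successors of any vertex \<open>x\<close> of the homogeneous tree
  can be mapped onto \<open>s(v)\<close> with fibres of size \<open>k(u)\<close>, and one may moreover prescribe the image
  of one successor of \<open>x\<close>. Send the \<open>n\<close>-th ancestor of \<open>w0_bar\<close> to the \<open>n\<close>-th ancestor of \<open>w0\<close>,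
  choose the local maps at these ancestors compatibly, and extend downwards to all other vertices;
  every vertex is reached because any two vertices have a common ancestor. Since the canonical flow
  is constant on sets of siblings, the fibre sizes are exactly what a flow submersion requires.
\<close>

section \<open>Distances in infinite trees\<close>

locale infinite_tree = pair_bidirected_digraph G for G :: "'a pair_pre_digraph" +
  assumes inf_tree: "inf_tree G"
begin

text \<open>The cycles excluded by \<open>inf_tree\<close> are lists of arcs, whereas the arguments
  below build lists of vertices. Zipping \<open>P\<close> with its rotation gives the arcs of the
  closed walk.\<close>

lemma no_cyclic_vertex_list:
  assumes "successively (\<lambda>u v. (u, v) \<in> parcs G) P" "distinct P" "length P \<ge> 3"
  shows "(last P, hd P) \<notin> parcs G"
proof
  assume closing: "(last P, hd P) \<in> parcs G"
  obtain x xs where P: "P = x # xs" using assms(3) by (cases P) auto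
  let ?p = "zip P (xs @ [x])"
  have walk: "pcas y (zip (y # ys) (ys @ [z])) z
      \<and> pawalk_verts y (zip (y # ys) (ys @ [z])) = y # ys @ [z]
      \<and> (successively (\<lambda>u v. (u, v) \<in> parcs G) (y # ys) \<longrightarrow> (last (y # ys), z) \<in> parcs G
          \<longrightarrow> set (zip (y # ys) (ys @ [z])) \<subseteq> parcs G)" for y ys z
    by (induction ys arbitrary: y) auto
  have "awalk x ?p x"
    using walk[of x xs x] assms(1) closing in_arcsD2 by (auto simp: awalk_def P)
  moreover have "distinct (tl (pawalk_verts x ?p))"
    using walk[of x xs x] assms(2) by (auto simp: P)
  ultimately have "cycle ?p" by (auto simp: cycle_def P)
  moreover have "length ?p \<ge> 3" using assms(3) by (simp add: P)
  ultimately show False using inf_tree by (auto simp: inf_tree_def)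
qed

lemma awalk_exists:
  assumes "x \<in> pverts G" "y \<in> pverts G"
  obtains p where "awalk x p y"
proof -
  \<comment> \<open>\<open>connected\<close> speaks of the symmetric closure; since the arcs are
    already symmetric, it yields directed walks.\<close>
  have "strongly_connected (with_proj G)"
    using inf_tree symmetric_connected_imp_strongly_connected[OF pair_sym_arcs]
    by (simp add: inf_tree_def)
  then have "x \<rightarrow>\<^sup>*\<^bsub>with_proj G\<^esub> y" using assms by (simp add: strongly_connected_def)
  then show thesis using that by (auto simp: reachable_awalk)
qed

lemma gdist_le_length: "awalk x p y \<Longrightarrow> gdist G x y \<le> length p"
  unfolding gdist_def by (rule Least_le) auto

lemma gdist_awalk:
  assumes "x \<in> pverts G" "y \<in> pverts G"
  obtains p where "awalk x p y" "length p = gdist G x y"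
proof -
  have "\<exists>n p. awalk x p y \<and> length p = n" using assms awalk_exists by metis
  then have "\<exists>p. awalk x p y \<and> length p = gdist G x y"
    unfolding gdist_def by (rule LeastI_ex)
  then show thesis using that by blast
qed

lemma gdist_self: "x \<in> pverts G \<Longrightarrow> gdist G x x = 0"
  using gdist_le_length[of x "[]" x] by (simp add: awalk_Nil_iff)

lemma gdist_eq_0D: "x \<in> pverts G \<Longrightarrow> y \<in> pverts G \<Longrightarrow> gdist G x y = 0 \<Longrightarrow> x = y"
  by (metis gdist_awalk length_0_conv awalk_Nil_iff)

lemma gdist_le_Suc:
  assumes "(x, y) \<in> parcs G" "z \<in> pverts G"
  shows "gdist G x z \<le> Suc (gdist G y z)"
proof -
  obtain p where p: "awalk y p z" "length p = gdist G y z"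
    using assms gdist_awalk in_arcsD2 by metis
  then have "awalk x ((x, y) # p) z"
    using assms(1) in_arcsD1 by (auto simp: awalk_Cons_iff)
  from gdist_le_length[OF this] show ?thesis using p by simp
qed

lemma gdist_SucE:
  assumes "x \<in> pverts G" "z \<in> pverts G" "gdist G x z = Suc k"
  obtains y where "(x, y) \<in> parcs G" "gdist G y z = k"
proof -
  obtain p where p: "awalk x p z" "length p = Suc k" using assms gdist_awalk by metis
  then obtain e p' where e: "p = e # p'" by (cases p) auto
  then have arc: "(x, snd e) \<in> parcs G" and walk: "awalk (snd e) p' z"
    using p by (cases e; auto simp: awalk_Cons_iff)+
  have "gdist G (snd e) z \<le> k" using gdist_le_length[OF walk] p e by simp
  moreover have "Suc k \<le> Suc (gdist G (snd e) z)" using gdist_le_Suc[OF arc assms(2)] assms by simp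
  ultimately show thesis using that arc by simp
qed

text \<open>
  Follow shortest paths from \<open>a\<close> and \<open>b\<close> towards \<open>z\<close> until they meet. The bound on the distance
  to \<open>z\<close> keeps vertices farther away from \<open>z\<close> off the path, so that adding one closes a cycle.
\<close>

lemma equidistant_path:
  assumes "z \<in> pverts G" "a \<in> pverts G" "b \<in> pverts G" "a \<noteq> b"
    and "gdist G a z = k" "gdist G b z = k"
  shows "\<exists>P. successively (\<lambda>u v. (u, v) \<in> parcs G) P \<and> distinct P \<and> length P \<ge> 3 \<and>
    hd P = a \<and> last P = b \<and> (\<forall>v\<in>set P. gdist G v z \<le> k)"
  using assms(2-)
proof (induction k arbitrary: a b)
  case 0
  then show ?case using gdist_eq_0D assms(1) by metis
next
  case (Suc k)
  obtain a' where a': "(a, a') \<in> parcs G" "gdist G a' z = k"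
    using gdist_SucE Suc.prems assms(1) by metis
  obtain b' where b': "(b, b') \<in> parcs G" "gdist G b' z = k"
    using gdist_SucE Suc.prems assms(1) by metis
  show ?case
  proof (cases "a' = b'")
    case True
    then have "distinct [a, a', b]" using a' b' Suc.prems by auto
    then show ?thesis
      using a' b' True Suc.prems arcs_symmetric by (intro exI[of _ "[a, a', b]"]) auto
  next
    case False
    obtain P where P: "successively (\<lambda>u v. (u, v) \<in> parcs G) P" "distinct P" "length P \<ge> 3"
      "hd P = a'" "last P = b'" "\<forall>v\<in>set P. gdist G v z \<le> k"
      using Suc.IH[of a' b'] False a' b' in_arcsD2 by metis
    have "a \<notin> set P" "b \<notin> set P" using P(6) Suc.prems by auto
    moreover have "P \<noteq> []" using P(3) by auto
    ultimately show ?thesis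
      using P a' b' arcs_symmetric Suc.prems
      by (intro exI[of _ "a # P @ [b]"])
        (auto simp: successively_append_iff successively_Cons le_Suc_eq)
  qed
qed

text \<open>The path that joins two equidistant vertices would be closed to a cycle by an arc
  between them.\<close>

lemma gdist_adjacent_neq:
  assumes "(a, b) \<in> parcs G" "z \<in> pverts G"
  shows "gdist G a z \<noteq> gdist G b z"
proof
  assume "gdist G a z = gdist G b z"
  moreover have "a \<noteq> b" using assms(1) pair_no_loops by fastforce
  ultimately obtain P where "successively (\<lambda>u v. (u, v) \<in> parcs G) P" "distinct P"
      "length P \<ge> 3" "hd P = a" "last P = b"
    using equidistant_path assms in_arcsD1 in_arcsD2 by metis
  then show False using no_cyclic_vertex_list assms(1) arcs_symmetric by metis
qed

text \<open>Two such neighbours are joined by a path staying within distance \<open>k\<close> of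
  \<open>z\<close>. It misses \<open>x\<close>, which lies at distance \<open>Suc k\<close>, so
  prepending \<open>x\<close> would close a cycle.\<close>

lemma closer_neighbour_unique:
  assumes "(x, a) \<in> parcs G" "(x, b) \<in> parcs G" "z \<in> pverts G"
    and "gdist G x z = Suc k" "gdist G a z = k" "gdist G b z = k"
  shows "a = b"
proof (rule ccontr)
  assume "a \<noteq> b"
  then obtain P where P: "successively (\<lambda>u v. (u, v) \<in> parcs G) P" "distinct P"
      "length P \<ge> 3" "hd P = a" "last P = b" "\<forall>v\<in>set P. gdist G v z \<le> k"
    using equidistant_path assms in_arcsD2 by metis
  then have "x \<notin> set P" "P \<noteq> []" using assms(4) by auto
  then show False
    using no_cyclic_vertex_list[of "x # P"] P assms arcs_symmetric by (auto simp: successively_Cons)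
qed

section \<open>Geodesic rays\<close>

lemma ray_in_verts: "f \<in> geodesic_rays G \<Longrightarrow> f n \<in> pverts G"
  by (auto simp: geodesic_rays_def)

lemma ray_gdist: "f \<in> geodesic_rays G \<Longrightarrow> i \<le> j \<Longrightarrow> gdist G (f i) (f j) = j - i"
  by (auto simp: geodesic_rays_def)

lemma ray_arc:
  assumes "f \<in> geodesic_rays G"
  shows "(f n, f (Suc n)) \<in> parcs G"
proof -
  have "gdist G (f n) (f (Suc n)) = Suc 0" using ray_gdist[OF assms, of n "Suc n"] by simp
  then obtain y where "(f n, y) \<in> parcs G" "gdist G y (f (Suc n)) = 0"
    using gdist_SucE ray_in_verts[OF assms] by metis
  then show ?thesis using gdist_eq_0D ray_in_verts[OF assms] in_arcsD2 by metis
qed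

lemma ray_tl: "f \<in> geodesic_rays G \<Longrightarrow> (\<lambda>n. f (Suc n)) \<in> geodesic_rays G"
  by (auto simp: geodesic_rays_def)

text \<open>As \<open>y\<close> is adjacent to \<open>f 0\<close>, its distance to
  \<open>f n\<close> is \<open>n + 1\<close> or \<open>n - 1\<close>. In the latter case
  \<open>y\<close> and \<open>f 1\<close> would both be the neighbour of \<open>f 0\<close> nearer
  to \<open>f n\<close>, hence equal.\<close>

lemma ray_Cons:
  assumes f: "f \<in> geodesic_rays G" and arc: "(y, f 0) \<in> parcs G" and "y \<noteq> f 1"
  shows "case_nat y f \<in> geodesic_rays G"
proof -
  have "gdist G y (f n) = Suc n" for n
  proof (rule ccontr)
    assume far: "gdist G y (f n) \<noteq> Suc n"
    have d: "gdist G (f 0) (f n) = n" using ray_gdist[OF f, of 0 n] by simp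
    then have "gdist G y (f n) \<noteq> n" "gdist G y (f n) \<le> Suc n" "n \<le> Suc (gdist G y (f n))"
      using gdist_adjacent_neq[OF arc] gdist_le_Suc[OF arc] gdist_le_Suc[OF arcs_symmetric[OF arc]]
        ray_in_verts[OF f] by metis+
    then obtain k where k: "n = Suc k" "gdist G y (f n) = k" using far by (cases n) auto
    moreover have "gdist G (f 1) (f n) = k" using ray_gdist[OF f, of 1 n] k by simp
    ultimately have "y = f 1"
      using closer_neighbour_unique[OF arcs_symmetric[OF arc] _ _ _ k(2)] ray_arc[OF f, of 0] d
        ray_in_verts[OF f] by simp
    then show False using assms(3) by simp
  qed
  then show ?thesis
    using f in_arcsD1[OF arc] gdist_self ray_in_verts[OF f]
    by (auto simp: geodesic_rays_def split: nat.splits)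
qed

end

section \<open>Trees with root at infinity\<close>

locale rooted_tree =
  fixes T :: "'a end_tree"
  assumes root_at_infinity: "tree_root_at_infinity T"

sublocale rooted_tree \<subseteq> infinite_tree "skeleton T"
  using root_at_infinity
  by (simp add: tree_root_at_infinity_def inf_tree_def infinite_tree_def infinite_tree_axioms_def)

context rooted_tree
begin

abbreviation pr :: "'a \<Rightarrow> 'a" where "pr \<equiv> predecessor T"

text \<open>A quotient element is by definition the image of one representative. The symmetry and
  transitivity of \<open>cofinal_rel\<close> needed later are extracted from this form by the next
  lemmas, by adding up shifts.\<close>

lemma root_endE:
  obtains f where "f \<in> geodesic_rays (skeleton T)"
    "root_end T = {g \<in> geodesic_rays (skeleton T). \<exists>i j. \<forall>n. f (i + n) = g (j + n)}"
proof -
  obtain f where "f \<in> geodesic_rays (skeleton T)" "root_end T = cofinal_rel (skeleton T) `` {f}"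
    using root_at_infinity
    by (auto simp: tree_root_at_infinity_def tree_boundary_def elim!: quotientE)
  then show thesis using that by (auto simp: cofinal_rel_def)
qed

lemma root_end_ray: "f \<in> root_end T \<Longrightarrow> f \<in> geodesic_rays (skeleton T)"
  by (rule root_endE) auto

lemma root_end_cofinal:
  assumes "f \<in> root_end T" "g \<in> geodesic_rays (skeleton T)" "\<And>n. f (i + n) = g (j + n)"
  shows "g \<in> root_end T"
proof -
  obtain h where h: "root_end T =
      {g \<in> geodesic_rays (skeleton T). \<exists>i j. \<forall>n. h (i + n) = g (j + n)}"
    by (rule root_endE)
  then obtain a b where ab: "\<And>n. h (a + n) = f (b + n)" using assms(1) by auto
  have "h (a + i + n) = g (b + j + n)" for n
    using ab[of "i + n"] assms(3)[of "b + n"] by (simp add: ac_simps)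
  then show ?thesis unfolding h using assms(2) by blast
qed

lemma root_end_rays_merge:
  assumes "f \<in> root_end T" "g \<in> root_end T"
  obtains i j where "\<And>n. f (i + n) = g (j + n)"
proof -
  obtain h where h: "root_end T =
      {g \<in> geodesic_rays (skeleton T). \<exists>i j. \<forall>n. h (i + n) = g (j + n)}"
    by (rule root_endE)
  then obtain a b c d where "\<And>n. h (a + n) = f (b + n)" "\<And>n. h (c + n) = g (d + n)"
    using assms by auto
  then have "f (b + (c + n)) = g (d + (a + n))" for n
    by (metis add.left_commute)
  then show thesis using that[of "b + c" "d + a"] by (simp add: add.assoc)
qed

text \<open>The two rays meet after equally many steps, this number being the distance from their
  common start. Their first steps are then both the neighbour nearer to a common later
  vertex.\<close>

lemma root_end_ray_step_unique:
  assumes f: "f \<in> root_end T" and g: "g \<in> root_end T" and "f 0 = g 0"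
  shows "f 1 = g 1"
proof -
  note rays = root_end_ray[OF f] root_end_ray[OF g]
  obtain i j where ij: "\<And>n. f (i + n) = g (j + n)" using root_end_rays_merge[OF f g] by metis
  have "gdist (skeleton T) (f 0) (f i) = i" "gdist (skeleton T) (g 0) (g j) = j"
    using ray_gdist[OF rays(1), of 0 i] ray_gdist[OF rays(2), of 0 j] by auto
  then have "i = j" using ij[of 0] assms(3) by simp
  \<comment> \<open>One step past the meeting point, so that the distance from \<open>f 0\<close> is
    positive even if \<open>i = 0\<close>.\<close>
  then have z: "f (Suc i) = g (Suc i)" using ij[of 1] by simp
  show ?thesis
  proof (rule closer_neighbour_unique)
    show "gdist (skeleton T) (f 0) (f (Suc i)) = Suc i"
      and "gdist (skeleton T) (f 1) (f (Suc i)) = i"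
      using ray_gdist[OF rays(1), of _ "Suc i"] by auto
    show "gdist (skeleton T) (g 1) (f (Suc i)) = i"
      using ray_gdist[OF rays(2), of _ "Suc i"] by (auto simp: z)
  qed (use ray_arc[OF rays(1), of 0] ray_arc[OF rays(2), of 0] ray_in_verts[OF rays(1)] assms(3) in auto)
qed

text \<open>This evaluates the definite description by any ray of the end. A neighbour of
  \<open>f 0\<close> lying on another such ray \<open>g\<close> from \<open>f 0\<close> is some
  \<open>g i\<close> with \<open>i \<le> 1\<close>, and \<open>i = 0\<close> would be a
  loop.\<close>

lemma predecessor_eq:
  assumes f: "f \<in> root_end T"
  shows "pr (f 0) = f 1"
  unfolding predecessor_def
proof (rule the_equality)
  show "f 1 \<in> neighbours T (f 0) \<and> (\<exists>g\<in>root_end T. g 0 = f 0 \<and> f 1 \<in> range g)"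
    using f ray_arc[OF root_end_ray[OF f], of 0] by (auto simp: neighbours_def)
next
  fix y assume y: "y \<in> neighbours T (f 0) \<and> (\<exists>g\<in>root_end T. g 0 = f 0 \<and> y \<in> range g)"
  then obtain g i where g: "g \<in> root_end T" "g 0 = f 0" and i: "y = g i"
    and arc: "(f 0, y) \<in> parcs (skeleton T)" by (auto simp: neighbours_def)
  note ray = root_end_ray[OF g(1)]
  have "gdist (skeleton T) (f 0) y \<le> Suc 0"
    using gdist_le_Suc[OF arc] gdist_self in_arcsD2[OF arc] by metis
  then have "i \<le> Suc 0" using ray_gdist[OF ray, of 0 i] i g by simp
  moreover have "y \<noteq> f 0" using pair_no_loops[OF arc] by simp
  then have "i \<noteq> 0" using i g(2) by metis
  ultimately show "y = f 1" using i root_end_ray_step_unique[OF f g(1)] g(2)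
    by (metis One_nat_def le_Suc_eq le_zero_eq)
qed

text \<open>A ray of the end can be carried across an edge: drop its first vertex or prefix a new
  one. Either way it stays cofinal with \<open>f\<close>.\<close>

lemma root_end_extend:
  assumes f: "f \<in> root_end T" and arc: "(y, f 0) \<in> parcs (skeleton T)"
  shows "y = f 1 \<and> (\<lambda>n. f (Suc n)) \<in> root_end T \<or> y \<noteq> f 1 \<and> case_nat y f \<in> root_end T"
proof (cases "y = f 1")
  case True
  then show ?thesis
    using root_end_cofinal[OF f ray_tl[OF root_end_ray[OF f]], of 1 0] by simp
next
  case False
  then show ?thesis
    using root_end_cofinal[OF f ray_Cons[OF root_end_ray[OF f] arc], of 0 1] by simp
qed

lemma root_end_rayE:
  assumes "x \<in> vertices T"
  obtains f where "f \<in> root_end T" "f 0 = x"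
proof -
  obtain h where h: "h \<in> root_end T"
  proof -
    obtain f where "f \<in> geodesic_rays (skeleton T)" "root_end T =
        {g \<in> geodesic_rays (skeleton T). \<exists>i j. \<forall>n. f (i + n) = g (j + n)}" by (rule root_endE)
    then have "f \<in> root_end T" by auto
    then show thesis by (rule that)
  qed
  obtain p where p: "awalk x p (h 0)"
    using awalk_exists[OF assms ray_in_verts[OF root_end_ray[OF h]]] by metis
  \<comment> \<open>Carry the ray \<open>h\<close> back along the walk, one edge at a time.\<close>
  then have "\<exists>f\<in>root_end T. f 0 = x"
  proof (induction p arbitrary: x)
    case Nil
    then show ?case using h by (auto simp: awalk_Nil_iff)
  next
    case (Cons e p)
    then obtain f where f: "f \<in> root_end T" "f 0 = snd e" by (auto simp: awalk_Cons_iff)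
    have "(x, f 0) \<in> parcs (skeleton T)" using Cons.prems f by (cases e) (auto simp: awalk_Cons_iff)
    from root_end_extend[OF f(1) this] show ?case
      by (metis (no_types, lifting) One_nat_def old.nat.simps(4))
  qed
  then show thesis using that by blast
qed

section \<open>The predecessor map, its fibres and its iterates\<close>

lemma predecessor_in_vertices: "x \<in> vertices T \<Longrightarrow> pr x \<in> vertices T"
  by (metis root_end_rayE predecessor_eq ray_in_verts root_end_ray)

lemma predecessor_arc: "x \<in> vertices T \<Longrightarrow> (x, pr x) \<in> parcs (skeleton T)"
  by (metis root_end_rayE predecessor_eq ray_arc root_end_ray One_nat_def)

text \<open>Take a ray of the end from \<open>x\<close>: either \<open>y\<close> is its second
  vertex, or prefixing \<open>y\<close> gives a ray of the end whose second vertex is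
  \<open>x\<close>.\<close>

lemma adjacent_cases:
  assumes "(y, x) \<in> parcs (skeleton T)"
  shows "y = pr x \<or> pr y = x"
proof -
  obtain f where f: "f \<in> root_end T" "f 0 = x"
    using root_end_rayE[of x] assms in_arcsD2 by metis
  then have "y = f 1 \<or> case_nat y f \<in> root_end T" using root_end_extend[OF f(1)] assms by metis
  then show ?thesis using f predecessor_eq[OF f(1)] predecessor_eq[of "case_nat y f"] by auto
qed

lemma level_predecessor: "x \<in> vertices T \<Longrightarrow> level T (pr x) = level T x + 1"
  using root_at_infinity by (simp add: tree_root_at_infinity_def)

lemma successors_eq:
  assumes "x \<in> vertices T"
  shows "successors T x = {y \<in> vertices T. pr y = x}"
proof (intro equalityI subsetI)
  fix y assume "y \<in> successors T x"
  then have "(y, x) \<in> parcs (skeleton T)" "y \<noteq> pr x"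
    using arcs_symmetric by (auto simp: successors_def neighbours_def)
  then show "y \<in> {y \<in> vertices T. pr y = x}" using adjacent_cases in_arcsD1 by auto
next
  fix y assume "y \<in> {y \<in> vertices T. pr y = x}"
  then have y: "y \<in> vertices T" "pr y = x" by auto
  then have "(x, y) \<in> parcs (skeleton T)" using predecessor_arc arcs_symmetric by blast
  \<comment> \<open>Otherwise going up twice would return to \<open>x\<close>, although the level
    has risen by 2.\<close>
  moreover have "y \<noteq> pr x" using level_predecessor[OF assms] level_predecessor[OF y(1)] y by auto
  ultimately show "y \<in> successors T x" by (simp add: successors_def neighbours_def)
qed

lemma finite_successors: "x \<in> vertices T \<Longrightarrow> finite (successors T x)"
  using inf_tree by (simp add: inf_tree_def successors_def neighbours_def)

lemma predecessor_pow_in_vertices: "x \<in> vertices T \<Longrightarrow> (pr ^^ n) x \<in> vertices T"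
  by (induction n) (auto intro: predecessor_in_vertices)

lemma level_predecessor_pow: "x \<in> vertices T \<Longrightarrow> level T ((pr ^^ n) x) = level T x + int n"
  by (induction n) (auto simp: level_predecessor predecessor_pow_in_vertices)

text \<open>Each edge of a walk joins a vertex to its predecessor, so prepending it adds one
  application of \<open>pr\<close> on one of the two sides.\<close>

lemma common_ancestor:
  assumes "x \<in> vertices T" "y \<in> vertices T"
  obtains i j where "(pr ^^ i) x = (pr ^^ j) y"
proof -
  obtain p where "awalk x p y" using awalk_exists assms by metis
  then have "\<exists>i j. (pr ^^ i) x = (pr ^^ j) y"
  proof (induction p arbitrary: x)
    case Nil
    then show ?case by (metis awalk_Nil_iff)
  next
    case (Cons e p)
    then have "\<exists>i j. (pr ^^ i) (snd e) = (pr ^^ j) y" by (auto simp: awalk_Cons_iff)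
    then obtain i j where ij: "(pr ^^ i) (snd e) = (pr ^^ j) y" by blast
    have "(x, snd e) \<in> parcs (skeleton T)" using Cons.prems by (cases e) (auto simp: awalk_Cons_iff)
    then consider "x = pr (snd e)" | "pr x = snd e" using adjacent_cases by blast
    then show ?case
    proof cases
      case 1
      then have "(pr ^^ i) x = (pr ^^ Suc j) y" using ij by (simp flip: funpow_swap1)
      then show ?thesis by blast
    next
      case 2
      then have "(pr ^^ Suc i) x = (pr ^^ j) y" using ij by (simp add: funpow_swap1)
      then show ?thesis by blast
    qed
  qed
  then show thesis using that by blast
qed

end

section \<open>Gluing local maps between successor sets\<close>

locale rooted_tree_pair = S: rooted_tree S + T: rooted_tree T
  for S :: "'b end_tree" and T :: "'a end_tree"
begin

text \<open>\<open>L x v c\<close> is an arbitrary requirement on the local map \<open>c\<close>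
  from the successors of \<open>x\<close> to those of \<open>v\<close>; fibre sizes will be put in
  for it. The freedom to prescribe one value of \<open>c\<close> is what lets ancestors of
  \<open>x0\<close> go to ancestors of \<open>v0\<close>.\<close>

lemma glue_local_maps:
  fixes L :: "'b \<Rightarrow> 'a \<Rightarrow> ('b \<Rightarrow> 'a) \<Rightarrow> bool"
  assumes nonempty: "\<And>x. x \<in> vertices S \<Longrightarrow> successors S x \<noteq> {}"
      "\<And>v. v \<in> vertices T \<Longrightarrow> successors T v \<noteq> {}"
    and local: "\<And>x v y u. x \<in> vertices S \<Longrightarrow> v \<in> vertices T \<Longrightarrow> y \<in> successors S x \<Longrightarrow>
      u \<in> successors T v \<Longrightarrow> \<exists>c. c ` successors S x \<subseteq> successors T v \<and> L x v c \<and> c y = u"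
    and x0: "x0 \<in> vertices S" and v0: "v0 \<in> vertices T"
  shows "\<exists>\<pi>. \<pi> x0 = v0 \<and> \<pi> ` vertices S \<subseteq> vertices T \<and>
    (\<forall>x\<in>vertices S. \<pi> (S.pr x) = T.pr (\<pi> x) \<and>
      (\<exists>c. L x (\<pi> x) c \<and> (\<forall>y\<in>successors S x. \<pi> y = c y)))"
proof -
  let ?a = "\<lambda>n. (S.pr ^^ n) x0" and ?b = "\<lambda>n. (T.pr ^^ n) v0"
  have a: "?a n \<in> vertices S" for n using S.predecessor_pow_in_vertices[OF x0] .
  have b: "?b n \<in> vertices T" for n using T.predecessor_pow_in_vertices[OF v0] .
  note a_level = S.level_predecessor_pow[OF x0]
  \<comment> \<open>Levels rise along the ancestors of \<open>x0\<close>, so \<open>x\<close>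
    determines \<open>n\<close> and at most one value of each local map is prescribed.\<close>
  have a_inj: "n = n'" if "?a n = ?a n'" for n n'
  proof -
    have "level S x0 + int n = level S x0 + int n'"
      unfolding a_level[symmetric] that ..
    then show ?thesis by simp
  qed
  have "\<exists>c. c ` successors S x \<subseteq> successors T v \<and> L x v c \<and>
      (\<forall>n. x = ?a (Suc n) \<longrightarrow> v = ?b (Suc n) \<longrightarrow> c (?a n) = ?b n)"
    if x: "x \<in> vertices S" and v: "v \<in> vertices T" for x v
  proof (cases "\<exists>n. x = ?a (Suc n) \<and> v = ?b (Suc n)")
    case True
    then obtain n where n: "x = ?a (Suc n)" "v = ?b (Suc n)" by blast
    then have "?a n \<in> successors S x" "?b n \<in> successors T v"
      using S.successors_eq[OF x] T.successors_eq[OF v] a[of n] b[of n] by auto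
    then obtain c where "c ` successors S x \<subseteq> successors T v" "L x v c" "c (?a n) = ?b n"
      using local[OF x v] by metis
    then show ?thesis using n a_inj by blast
  next
    case False
    then show ?thesis using local[OF x v] nonempty x v by (metis ex_in_conv)
  qed
  then obtain C where C: "\<And>x v. x \<in> vertices S \<Longrightarrow> v \<in> vertices T \<Longrightarrow>
      C x v ` successors S x \<subseteq> successors T v \<and> L x v (C x v) \<and>
      (\<forall>n. x = ?a (Suc n) \<longrightarrow> v = ?b (Suc n) \<longrightarrow> C x v (?a n) = ?b n)" by metis
  \<comment> \<open>\<open>F n j\<close> is the intended map on the \<open>j\<close>-th generation below the \<open>n\<close>-th ancestor of \<open>x0\<close>.\<close>
  define F where "F n j = rec_nat (\<lambda>_. ?b n) (\<lambda>_ h x. C (S.pr x) (h (S.pr x)) x) j" for n j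
  have F0: "F n 0 x = ?b n" and FS: "F n (Suc j) x = C (S.pr x) (F n j (S.pr x)) x" for n j x
    by (simp_all add: F_def)
  \<comment> \<open>Starting one ancestor higher changes nothing: at \<open>j = 0\<close> this is
    the prescribed value of \<open>C\<close> at \<open>?a n\<close>. The condition on
    \<open>x\<close> matters because \<open>F n 0\<close> is constant.\<close>
  have F_Suc: "F (Suc n) (Suc j) x = F n j x" if "(S.pr ^^ j) x = ?a n" "x \<in> vertices S" for n j x
    using that
  proof (induction j arbitrary: x)
    case 0
    then show ?case using C[OF a[of "Suc n"] b[of "Suc n"]] by (simp add: FS F0)
  next
    case (Suc j)
    then show ?case
      using S.predecessor_in_vertices FS[of "Suc n" "Suc j" x] FS[of n j x]
      by (simp add: funpow_swap1)
  qed
  have F_shift: "F (d + n) (d + j) x = F n j x" if "(S.pr ^^ j) x = ?a n" "x \<in> vertices S" for d n j x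
  proof (induction d)
    case (Suc d)
    have "(S.pr ^^ (d + j)) x = ?a (d + n)" using that by (simp add: funpow_add)
    from F_Suc[OF this that(2)] show ?case using Suc by simp
  qed simp
  have F_eq: "F n j x = F n' j' x"
    if "(S.pr ^^ j) x = ?a n" "(S.pr ^^ j') x = ?a n'" "x \<in> vertices S" for n j n' j' x
  proof -
    have "level S x + int j = level S x0 + int n" "level S x + int j' = level S x0 + int n'"
      unfolding a_level[symmetric] S.level_predecessor_pow[OF that(3), symmetric] that by simp_all
    \<comment> \<open>Both index pairs thus shift to the same pair, by \<open>n'\<close> and by
      \<open>n\<close> respectively.\<close>
    then have "n + j' = n' + j" by linarith
    then show ?thesis
      using F_shift[OF that(1,3), of "n' "] F_shift[OF that(2,3), of n] by (simp add: add.commute)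
  qed
  have "\<forall>x\<in>vertices S. \<exists>w n j. (S.pr ^^ j) x = ?a n \<and> w = F n j x"
    using S.common_ancestor[OF _ x0] by blast
  from bchoice[OF this] obtain \<pi>
    where \<pi>: "\<And>x. x \<in> vertices S \<Longrightarrow> \<exists>n j. (S.pr ^^ j) x = ?a n \<and> \<pi> x = F n j x" by blast
  have \<pi>_F: "\<pi> x = F n j x" if "(S.pr ^^ j) x = ?a n" "x \<in> vertices S" for n j x
    using \<pi>[OF that(2)] F_eq[OF _ that] by auto
  have step: "\<pi> x = C (S.pr x) (\<pi> (S.pr x)) x" if x: "x \<in> vertices S" for x
  proof -
    obtain n j where nj: "(S.pr ^^ j) x = ?a n" using \<pi>[OF x] by blast
    \<comment> \<open>Passing to the next ancestor makes the generation index positive, so that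
      \<open>FS\<close> applies also when \<open>j = 0\<close>.\<close>
    then have up: "(S.pr ^^ j) (S.pr x) = ?a (Suc n)" "(S.pr ^^ Suc j) x = ?a (Suc n)"
      by (simp_all flip: funpow_swap1)
    have "\<pi> x = F (Suc n) (Suc j) x" using \<pi>_F[OF up(2) x] .
    also have "\<dots> = C (S.pr x) (\<pi> (S.pr x)) x"
      using \<pi>_F[OF up(1) S.predecessor_in_vertices[OF x]] by (simp add: FS)
    finally show ?thesis .
  qed
  have F_in: "F n j x \<in> vertices T" if "(S.pr ^^ j) x = ?a n" "x \<in> vertices S" for n j x
    using that
  proof (induction j arbitrary: x)
    case 0
    then show ?case using b by (simp add: F0)
  next
    case (Suc j)
    let ?v = "F n j (S.pr x)"
    have y: "S.pr x \<in> vertices S" using Suc.prems S.predecessor_in_vertices by blast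
    have v: "?v \<in> vertices T" using Suc y by (simp add: funpow_swap1)
    have "x \<in> successors S (S.pr x)" using S.successors_eq[OF y] Suc.prems by simp
    then have "C (S.pr x) ?v x \<in> successors T ?v" using C[OF y v] by blast
    then show ?case using T.successors_eq[OF v] by (simp add: FS)
  qed
  have in_T: "\<pi> x \<in> vertices T" if "x \<in> vertices S" for x
    using \<pi>[OF that] F_in[OF _ that] by auto
  have "\<pi> (S.pr x) = T.pr (\<pi> x)" if x: "x \<in> vertices S" for x
  proof -
    note y = S.predecessor_in_vertices[OF x]
    have "x \<in> successors S (S.pr x)" using S.successors_eq[OF y] x by simp
    then have "\<pi> x \<in> successors T (\<pi> (S.pr x))" using C[OF y in_T[OF y]] step[OF x] by auto
    then show ?thesis using T.successors_eq[OF in_T[OF y]] by simp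
  qed
  moreover have "\<pi> y = C x (\<pi> x) y" if "x \<in> vertices S" "y \<in> successors S x" for x y
    using step[of y] S.successors_eq that by simp
  moreover have "\<pi> x0 = v0" using \<pi>_F[of 0 x0 0] x0 by (simp add: F0)
  ultimately show ?thesis
    using in_T C by (intro exI[of _ \<pi>]) (auto intro!: exI)
qed

end

section \<open>Maps with prescribed fibre sizes\<close>

text \<open>Any bijection of \<open>A\<close> with the disjoint union of blocks of sizes
  \<open>k u\<close>, followed by the projection to \<open>B\<close>, has the right fibres. Swapping
  \<open>a\<close> beforehand with the preimage of \<open>(b, 0)\<close>, which exists as
  \<open>k b > 0\<close>, sends \<open>a\<close> to \<open>b\<close>.\<close>

lemma map_with_fibre_cards:
  assumes "finite A" "finite B" "(\<Sum>u\<in>B. k u) = card A" "a \<in> A" "b \<in> B" "k b > 0"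
  shows "\<exists>c. c ` A \<subseteq> B \<and> (\<forall>u\<in>B. card {y \<in> A. c y = u} = k u) \<and> c a = b"
proof -
  let ?D = "SIGMA u:B. {..<k u}"
  have "card ?D = card A" using assms(2,3) by simp
  then obtain h where h: "bij_betw h A ?D"
    using finite_same_card_bij[of A ?D] assms(1,2) by auto
  have "(b, 0) \<in> h ` A" using assms(5,6) by (simp add: bij_betw_imp_surj_on[OF h])
  then obtain a' where a': "a' \<in> A" "h a' = (b, 0)" by auto
  let ?g = "h \<circ> transpose a a'"
  have g: "bij_betw ?g A ?D"
    using h permutes_imp_bij[OF permutes_swap_id[OF assms(4) a'(1)]] bij_betw_trans by blast
  have "card {y \<in> A. fst (?g y) = u} = k u" if u: "u \<in> B" for u
  proof -
    have "?g ` {y \<in> A. fst (?g y) = u} = {w \<in> ?g ` A. fst w = u}" by auto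
    also have "\<dots> = {u} \<times> {..<k u}" using g u by (auto simp: bij_betw_def)
    finally have "bij_betw ?g {y \<in> A. fst (?g y) = u} ({u} \<times> {..<k u})"
      using g by (auto simp: bij_betw_def inj_on_def)
    then show ?thesis using bij_betw_same_card by fastforce
  qed
  moreover have "fst (?g y) \<in> B" if "y \<in> A" for y
    using bij_betwE[OF g] that by (metis SigmaE fst_conv)
  moreover have "fst (?g a) = b" using a' by simp
  ultimately show ?thesis by (intro exI[of _ "fst \<circ> ?g"]) auto
qed

section \<open>The canonical flow\<close>

lemma canonical_flow_predecessor:
  assumes "tree_root_at_infinity T" "q > 0" "x \<in> vertices T"
  shows "canonical_flow q T (predecessor T x) = real q * canonical_flow q T x"
  using assms by (simp add: canonical_flow_def tree_root_at_infinity_def power_int_add)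

lemma flow_tree_canonical:
  assumes "homogeneous_tree q T" "q > 0"
  shows "flow_tree T (canonical_flow q T)"
proof -
  interpret rooted_tree T using assms(1) by unfold_locales (simp add: homogeneous_tree_def)
  have "canonical_flow q T x = (\<Sum>y\<in>successors T x. canonical_flow q T y)"
    if x: "x \<in> vertices T" for x
  proof -
    have "canonical_flow q T y = canonical_flow q T x / q" if "y \<in> successors T x" for y
      using that canonical_flow_predecessor[OF root_at_infinity assms(2), of y]
        successors_eq[OF x] assms(2) by auto
    then have "(\<Sum>y\<in>successors T x. canonical_flow q T y)
        = real (card (successors T x)) * (canonical_flow q T x / q)" by simp
    also have "\<dots> = canonical_flow q T x"
      using assms x by (simp add: homogeneous_tree_def)
    finally show ?thesis by simp
  qed
  moreover have "canonical_flow q T x > 0" for x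
    using assms(2) by (simp add: canonical_flow_def)
  ultimately show ?thesis
    using root_at_infinity unfolding flow_tree_def flow_measure_def by blast
qed

lemma flow_submersion_canonical:
  assumes q: "q > 0" and T: "tree_root_at_infinity T" and m: "flow_measure T m"
    and rational: "uniformly_rational q T m" and Tq: "homogeneous_tree q Tq"
    and x0: "x0 \<in> vertices Tq" and v0: "v0 \<in> vertices T"
  shows "\<exists>\<pi>. flow_submersion Tq (canonical_flow q Tq) T m \<pi> \<and> \<pi> x0 = v0"
proof -
  interpret rooted_tree_pair Tq T
    using T Tq by unfold_locales (simp_all add: homogeneous_tree_def)
  have m_pos: "m v > 0" and m_sum: "m v = (\<Sum>u\<in>successors T v. m u)" if "v \<in> vertices T" for v
    using m that by (auto simp: flow_measure_def)
  obtain k where k: "\<And>v. v \<in> vertices T \<Longrightarrow> k v > (0::nat) \<and> real q * m v / m (T.pr v) = real (k v)"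
    using rational unfolding uniformly_rational_def by metis
  have k_succ: "real (k u) = real q * m u / m v" "k u > 0"
    if "v \<in> vertices T" "u \<in> successors T v" for u v
    using k[of u] T.successors_eq[OF that(1)] that(2) by auto
  have card_Tq: "card (successors Tq x) = q" if "x \<in> vertices Tq" for x
    using Tq that by (simp add: homogeneous_tree_def)
  \<comment> \<open>This is the flow equation at \<open>v\<close>, multiplied by
    \<open>q / m v\<close>.\<close>
  have sum_k: "(\<Sum>u\<in>successors T v. k u) = q" if v: "v \<in> vertices T" for v
  proof -
    have "real (\<Sum>u\<in>successors T v. k u) = (\<Sum>u\<in>successors T v. real q * m u / m v)"
      using k_succ[OF v] by simp
    also have "\<dots> = real q * m v / m v"
      unfolding m_sum[OF v, symmetric] sum_divide_distrib[symmetric] sum_distrib_left[symmetric] ..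
    finally show ?thesis using m_pos[OF v] by (simp del: of_nat_sum)
  qed
  define L where "L x v c \<longleftrightarrow> (\<forall>u\<in>successors T v. card {y \<in> successors Tq x. c y = u} = k u)"
    for x v and c :: "'b \<Rightarrow> 'a"
  have "\<exists>\<pi>. \<pi> x0 = v0 \<and> \<pi> ` vertices Tq \<subseteq> vertices T \<and>
    (\<forall>x\<in>vertices Tq. \<pi> (S.pr x) = T.pr (\<pi> x) \<and>
      (\<exists>c. L x (\<pi> x) c \<and> (\<forall>y\<in>successors Tq x. \<pi> y = c y)))"
  proof (rule glue_local_maps)
    show "successors Tq x \<noteq> {}" if "x \<in> vertices Tq" for x
      using card_Tq[OF that] q by auto
    show "successors T v \<noteq> {}" if "v \<in> vertices T" for v
      using sum_k[OF that] q by auto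
    show "\<exists>c. c ` successors Tq x \<subseteq> successors T v \<and> L x v c \<and> c y = u"
      if "x \<in> vertices Tq" "v \<in> vertices T" "y \<in> successors Tq x" "u \<in> successors T v" for x v y u
      unfolding L_def using that k_succ sum_k card_Tq
      by (intro map_with_fibre_cards) (auto intro: S.finite_successors T.finite_successors)
  qed (use x0 v0 in auto)
  then obtain \<pi> where \<pi>: "\<pi> x0 = v0" "\<And>x. x \<in> vertices Tq \<Longrightarrow> \<pi> x \<in> vertices T"
      "\<And>x. x \<in> vertices Tq \<Longrightarrow> \<pi> (S.pr x) = T.pr (\<pi> x)"
    and \<pi>_loc: "\<And>x. x \<in> vertices Tq \<Longrightarrow> \<exists>c. L x (\<pi> x) c \<and> (\<forall>y\<in>successors Tq x. \<pi> y = c y)"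
    by blast
  have fibre: "card {y \<in> successors Tq x. \<pi> y = u} = k u"
    if x: "x \<in> vertices Tq" and u: "u \<in> successors T (\<pi> x)" for x u
  proof -
    obtain c where c: "L x (\<pi> x) c" "\<forall>y\<in>successors Tq x. \<pi> y = c y" using \<pi>_loc[OF x] by blast
    then have "{y \<in> successors Tq x. \<pi> y = u} = {y \<in> successors Tq x. c y = u}" by auto
    then show ?thesis using c(1) u by (simp add: L_def)
  qed
  have "\<pi> ` successors Tq x = successors T (\<pi> x)" if x: "x \<in> vertices Tq" for x
  proof (intro equalityI subsetI)
    fix u assume "u \<in> \<pi> ` successors Tq x"
    then show "u \<in> successors T (\<pi> x)"
      using S.successors_eq[OF x] T.successors_eq[OF \<pi>(2)[OF x]] \<pi>(2,3) by auto
  next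
    fix u assume u: "u \<in> successors T (\<pi> x)"
    \<comment> \<open>Surjectivity onto the successors comes from the positivity of
      \<open>k u\<close>.\<close>
    then have "card {y \<in> successors Tq x. \<pi> y = u} > 0"
      using fibre[OF x u] k_succ(2)[OF \<pi>(2)[OF x] u] by simp
    then show "u \<in> \<pi> ` successors Tq x" by (auto simp: card_gt_0_iff)
  qed
  then have sub: "submersion Tq T \<pi>" using \<pi> by (auto simp: submersion_def)
  have "m (\<pi> x) / m (T.pr (\<pi> x)) =
      sum (canonical_flow q Tq) ({y \<in> vertices Tq. \<pi> y = \<pi> x} \<inter> successors Tq (S.pr x))
        / canonical_flow q Tq (S.pr x)" if x: "x \<in> vertices Tq" for x
  proof -
    let ?x' = "S.pr x"
    have x': "?x' \<in> vertices Tq" using S.predecessor_in_vertices[OF x] .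
    have u: "\<pi> x \<in> successors T (\<pi> ?x')"
      using T.successors_eq[OF \<pi>(2)[OF x']] \<pi>(2,3)[OF x] by simp
    have set_eq: "{y \<in> vertices Tq. \<pi> y = \<pi> x} \<inter> successors Tq ?x' = {y \<in> successors Tq ?x'. \<pi> y = \<pi> x}"
      using S.successors_eq[OF x'] by auto
    \<comment> \<open>Siblings carry equal mass, so the measure of a fibre is its cardinality
      \<open>k (\<pi> x)\<close> times the mass of \<open>x\<close>. Division by the mass of
      \<open>?x'\<close>, which is \<open>q\<close> times that of \<open>x\<close>, leaves
      \<open>k (\<pi> x) / q\<close>.\<close>
    have "canonical_flow q Tq y = canonical_flow q Tq x" if "y \<in> successors Tq ?x'" for y
      using canonical_flow_predecessor[OF S.root_at_infinity q x]
        canonical_flow_predecessor[OF S.root_at_infinity q, of y] S.successors_eq[OF x'] that q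
      by auto
    then have "sum (canonical_flow q Tq) {y \<in> successors Tq ?x'. \<pi> y = \<pi> x}
        = real (k (\<pi> x)) * canonical_flow q Tq x"
      using fibre[OF x' u] by simp
    moreover have "canonical_flow q Tq x > 0" using q by (simp add: canonical_flow_def)
    ultimately show ?thesis
      using k_succ(1)[OF \<pi>(2)[OF x'] u] canonical_flow_predecessor[OF S.root_at_infinity q x] q
      unfolding set_eq by (simp add: \<pi>(3)[OF x])
  qed
  then have "flow_submersion Tq (canonical_flow q Tq) T m \<pi>"
    using flow_tree_canonical[OF Tq q] T m sub by (simp add: flow_submersion_def flow_tree_def)
  then show ?thesis using \<pi>(1) by blast
qed

theorem proposition3p18:
  fixes q :: nat
    and T :: "'a end_tree" and m :: "'a \<Rightarrow> real"
    and Tq :: "'b end_tree"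
  assumes "q > 0"
    and "tree_root_at_infinity T"
    and "flow_measure T m"
    and "uniformly_rational q T m"
    and "homogeneous_tree q Tq"
  shows "flow_quotient T m Tq (canonical_flow q Tq) \<and>
    (\<forall>w0_bar\<in>vertices Tq. \<forall>w0\<in>vertices T.
       \<exists>\<pi>. flow_submersion Tq (canonical_flow q Tq) T m \<pi> \<and> \<pi> w0_bar = w0)"
proof -
  note submersions = flow_submersion_canonical[OF assms]
  \<comment> \<open>The quotient claim fixes no base points, so some must be supplied; infinite
    vertex sets provide them.\<close>
  have "vertices Tq \<noteq> {}" "vertices T \<noteq> {}"
    using assms(2,5)
    by (auto simp: homogeneous_tree_def tree_root_at_infinity_def inf_tree_def)
  then obtain x0 v0 where "x0 \<in> vertices Tq" "v0 \<in> vertices T" by blast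
  then show ?thesis using submersions by (auto simp: flow_quotient_def)
qed

end
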